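(* Every proof in the sequent system $\mathcal J$ can be transformed into a proof in $\mathcal J$ of the same root-sequent with no applications of the mix rule. That is, for all formulae $A,B$, if the sequent $A\vdash B$ has a proof in $\mathcal J$, then it has a proof in $\mathcal J$ in which the mix rule is not used.
   Context: **Formulae and sequents.** The set $\mathcal F$ of formulae is generated from a countable set $\mathcal L$ of propositional letters and the constants $\top$ and $\bot$ by the binary connectives $\wedge,\vee,\to$. A sequent of $\mathcal J$ is an expression $A\vdash B$ with $A,B\in\mathcal F$ (exactly one formula on each side). **Contexts.** $\wedge$-contexts are defined inductively: the symbol $\Box$ is a $\wedge$-context; if $G$ is a $\wedge$-context and $A\in\mathcal F$, then $(G\wedge A)$ and $(A\wedge G)$ are $\wedge$-contexts; if $G$ and $H$ are $\wedge$-contexts, then $(G\wedge H)$ is a $\wedge$-context. A $\wedge_1$-context is a $\wedge$-context in which $\Box$ occurs exactly once. For a $\wedge$-context $G$ and $A\in\mathcal F$, $G(A)$ is the formula obtained by substituting $A$ for every $\Box$ in $G$. **Axioms of $\mathcal J$:** $A\vdash A$ and $\bot\vdash A$, for every $A\in\mathcal F$. **Structural rules of $\mathcal J$** ($F$ is an arbitrary $\wedge_1$-context, $G$ an arbitrary $\wedge$-context, and $A,B,C,D$ arbitrary formulae): - $(\beta^{\leftarrow}_F)$: from $F(A\wedge(B\wedge C))\vdash D$ infer $F((A\wedge B)\wedge C)\vdash D$; - $(\beta^{\to}_F)$: from $F((A\wedge B)\wedge C)\vdash D$ infer $F(A\wedge(B\wedge C))\vdash D$; - $(\gamma_F)$: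 from $F(A\wedge B)\vdash C$ infer $F(B\wedge A)\vdash C$; - $(\omega_F)$: from $F(A\wedge A)\vdash B$ infer $F(A)\vdash B$; - $(\theta^A_F)$: from $F(\top)\vdash B$ infer $F(A)\vdash B$; - $(\tau_F)$: from $F(A)\vdash B$ infer $F(A\wedge\top)\vdash B$; - $(\tau^i_F)$: from $F(A\wedge\top)\vdash B$ infer $F(A)\vdash B$; - mix: from $A\vdash B$ and $G(B)\vdash C$ infer $G(A)\vdash C$. **Rules for connectives of $\mathcal J$:** - $(\wedge)$: from $A\vdash C$ and $B\vdash D$ infer $A\wedge B\vdash C\wedge D$; - $(\Diamond)$: from $A\wedge C\vdash D$ and $B\wedge C\vdash D$ infer $(A\vee B)\wedge C\vdash D$; - $(+C)$: from $A\vdash B$ infer $A\vdash B\vee C$; - $(B+)$: from $A\vdash C$ infer $A\vdash B\vee C$; - $(\ast)$: from $A\wedge B\vdash C$ infer $B\vdash A\to C$; - $(\rhd)$: from $A\vdash B$ and $C\wedge D\vdash E$ infer $(A\wedge(B\to C))\wedge D\vdash E$. A proof of $A\vdash B$ in $\mathcal J$ is a finite tree of sequents with $A\vdash B$ at the root, axioms at the leaves, and consecutive nodes connected by the inference rules above. *)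

theory Defs
  imports Main "HOL-Library.Countable"
begin

datatype 'l form =
    Letter 'l
  | Top (\<open>\<^bold>\<top>\<close>)
  | Bot (\<open>\<^bold>\<bottom>\<close>)
  | And "'l form" "'l form" (infixr \<open>\<^bold>\<and>\<close> 70)
  | Or "'l form" "'l form" (infixr \<open>\<^bold>\<or>\<close> 65)
  | Imp "'l form" "'l form" (infixr \<open>\<^bold>\<rightarrow>\<close> 60)

datatype 'l sequent = Seq "'l form" "'l form" (infix \<open>\<turnstile>\<close> 55)

text \<open>
  The contexts built from the hole with conjunction. Formulae contain no hole, so the
  expressions \<open>G \<and> A\<close>, \<open>A \<and> G\<close> and \<open>G \<and> H\<close> (with \<open>G\<close>, \<open>H\<close> contexts and \<open>A\<close> a formula)
  never coincide and the generation is free. Every context has at least one hole.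
\<close>

datatype 'l ctxt =
    Hole
  | CtxtL "'l ctxt" "'l form"     \<comment> \<open>\<open>G \<and> A\<close>\<close>
  | CtxtR "'l form" "'l ctxt"     \<comment> \<open>\<open>A \<and> G\<close>\<close>
  | CtxtLR "'l ctxt" "'l ctxt"    \<comment> \<open>\<open>G \<and> H\<close>\<close>

primrec holes :: "'l ctxt \<Rightarrow> nat" where
  "holes Hole = 1"
| "holes (CtxtL G A) = holes G"
| "holes (CtxtR A G) = holes G"
| "holes (CtxtLR G H) = holes G + holes H"

definition one_hole :: "'l ctxt \<Rightarrow> bool" where
  "one_hole F \<longleftrightarrow> holes F = 1"

primrec fill :: "'l ctxt \<Rightarrow> 'l form \<Rightarrow> 'l form" where
  "fill Hole A = A"
| "fill (CtxtL G B) A = fill G A \<^bold>\<and> B"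
| "fill (CtxtR B G) A = B \<^bold>\<and> fill G A"
| "fill (CtxtLR G H) A = fill G A \<^bold>\<and> fill H A"

datatype rule_name =
    Ax_Id | Ax_Bot
  | Beta_Left | Beta_Right | Gamma | Omega | Theta | Tau | Tau_Inv | Mix
  | Conj | Diamond | Plus_Right | Plus_Left | Star | Triangle

text \<open>
  \<open>inference r ps s\<close>: the sequent \<open>s\<close> follows from the list of premises \<open>ps\<close> by one
  application of the rule \<open>r\<close>; the axioms are the rules without premises.
\<close>

inductive inference :: "rule_name \<Rightarrow> 'l sequent list \<Rightarrow> 'l sequent \<Rightarrow> bool" where
  ax_id:      "inference Ax_Id [] (A \<turnstile> A)"
| ax_bot:     "inference Ax_Bot [] (\<^bold>\<bottom> \<turnstile> A)"
| beta_left:  "one_hole F \<Longrightarrow>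
    inference Beta_Left [fill F (A \<^bold>\<and> (B \<^bold>\<and> C)) \<turnstile> D] (fill F ((A \<^bold>\<and> B) \<^bold>\<and> C) \<turnstile> D)"
| beta_right: "one_hole F \<Longrightarrow>
    inference Beta_Right [fill F ((A \<^bold>\<and> B) \<^bold>\<and> C) \<turnstile> D] (fill F (A \<^bold>\<and> (B \<^bold>\<and> C)) \<turnstile> D)"
| gamma:      "one_hole F \<Longrightarrow> inference Gamma [fill F (A \<^bold>\<and> B) \<turnstile> C] (fill F (B \<^bold>\<and> A) \<turnstile> C)"
| omega:      "one_hole F \<Longrightarrow> inference Omega [fill F (A \<^bold>\<and> A) \<turnstile> B] (fill F A \<turnstile> B)"
| theta:      "one_hole F \<Longrightarrow> inference Theta [fill F \<^bold>\<top> \<turnstile> B] (fill F A \<turnstile> B)"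
| tau:        "one_hole F \<Longrightarrow> inference Tau [fill F A \<turnstile> B] (fill F (A \<^bold>\<and> \<^bold>\<top>) \<turnstile> B)"
| tau_inv:    "one_hole F \<Longrightarrow> inference Tau_Inv [fill F (A \<^bold>\<and> \<^bold>\<top>) \<turnstile> B] (fill F A \<turnstile> B)"
| mix:        "inference Mix [A \<turnstile> B, fill G B \<turnstile> C] (fill G A \<turnstile> C)"
| conj:       "inference Conj [A \<turnstile> C, B \<turnstile> D] (A \<^bold>\<and> B \<turnstile> C \<^bold>\<and> D)"
| diamond:    "inference Diamond [A \<^bold>\<and> C \<turnstile> D, B \<^bold>\<and> C \<turnstile> D] ((A \<^bold>\<or> B) \<^bold>\<and> C \<turnstile> D)"
| plus_right: "inference Plus_Right [A \<turnstile> B] (A \<turnstile> B \<^bold>\<or> C)"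
| plus_left:  "inference Plus_Left [A \<turnstile> C] (A \<turnstile> B \<^bold>\<or> C)"
| star:       "inference Star [A \<^bold>\<and> B \<turnstile> C] (B \<turnstile> A \<^bold>\<rightarrow> C)"
| triangle:   "inference Triangle [A \<turnstile> B, C \<^bold>\<and> D \<turnstile> E] ((A \<^bold>\<and> (B \<^bold>\<rightarrow> C)) \<^bold>\<and> D \<turnstile> E)"

text \<open>
  Each node of a proof tree records the rule applied there, since one and the same step
  may be an instance of several rules, mix among them.
\<close>

datatype 'l tree = Node rule_name (root: "'l sequent") "'l tree list"

fun is_proof :: "'l tree \<Rightarrow> bool" where
  "is_proof (Node r s ts) \<longleftrightarrow> inference r (map root ts) s \<and> (\<forall>t\<in>set ts. is_proof t)"

fun mix_free :: "'l tree \<Rightarrow> bool" where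
  "mix_free (Node r s ts) \<longleftrightarrow> r \<noteq> Mix \<and> (\<forall>t\<in>set ts. mix_free t)"

end

theory Submission
  imports Defs
begin

text \<open>
  Mix is eliminated semantically, in the manner of Okada's cut elimination by phase semantics.
  Write \<open>X \<tturnstile> D\<close> when \<open>X \<turnstile> D\<close> has a mix-free proof. Each formula \<open>A\<close> is given a
  set \<open>val A\<close> of formulae, to be thought of as the antecedents that force \<open>A\<close>; the
  construction is an intuitionistic model whose points are antecedents and whose atomic facts and
  covering relation are read off from mix-free provability alone.

  The argument rests on two facts about this model. It is sound for all of the system, mix
  included: a provable \<open>A \<turnstile> B\<close> yields \<open>val A \<subseteq> val B\<close>
  (\<open>val_sound\<close>). This is where mix costs nothing, since it amounts to transitivity of
  inclusion together with monotonicity of contexts. And the model is tied to mix-free provability by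
  \<open>A \<in> val A\<close> and \<open>val A \<subseteq> {X. X \<tturnstile> A}\<close>
  (\<open>val_adequate\<close>): the first half uses the left rules, the second half the right rules.
  Hence a provable \<open>A \<turnstile> B\<close> gives
  \<open>A \<in> val A \<subseteq> val B \<subseteq> {X. X \<tturnstile> B}\<close>, a mix-free proof of
  \<open>A \<turnstile> B\<close>.

  What makes the two facts compatible is that every \<open>val A\<close> is closed
  (\<open>val_closed\<close>): it is an intersection of sets of the form
  \<open>{X. X \<and> E \<tturnstile> D}\<close>. Left rules act on such sets with \<open>E\<close> as the side
  formula, so every \<open>val A\<close> is stable under them.
\<close>

section \<open>Mix-free provability\<close>

definition mix_free_provable :: "'l form \<Rightarrow> 'l form \<Rightarrow> bool" (infix \<open>\<tturnstile>\<close> 55) where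
  "A \<tturnstile> B \<longleftrightarrow> (\<exists>Q. is_proof Q \<and> root Q = (A \<turnstile> B) \<and> mix_free Q)"

lemma mfp_axiom:
  assumes "inference r [] (A \<turnstile> B)" and "r \<noteq> Mix"
  shows "A \<tturnstile> B"
  using assms unfolding mix_free_provable_def
  by (intro exI[of _ "Node r (A \<turnstile> B) []"]) simp

lemma mfp_step1:
  assumes "inference r [A' \<turnstile> B'] (A \<turnstile> B)" and "r \<noteq> Mix" and "A' \<tturnstile> B'"
  shows "A \<tturnstile> B"
proof -
  obtain Q where "is_proof Q" "root Q = (A' \<turnstile> B')" "mix_free Q"
    using assms(3) unfolding mix_free_provable_def by blast
  with assms(1,2) show ?thesis
    unfolding mix_free_provable_def by (intro exI[of _ "Node r (A \<turnstile> B) [Q]"]) simp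
qed

lemma mfp_step2:
  assumes "inference r [A1 \<turnstile> B1, A2 \<turnstile> B2] (A \<turnstile> B)" and "r \<noteq> Mix"
    and "A1 \<tturnstile> B1" and "A2 \<tturnstile> B2"
  shows "A \<tturnstile> B"
proof -
  obtain Q1 Q2 where "is_proof Q1" "root Q1 = (A1 \<turnstile> B1)" "mix_free Q1"
    "is_proof Q2" "root Q2 = (A2 \<turnstile> B2)" "mix_free Q2"
    using assms(3,4) unfolding mix_free_provable_def by blast
  with assms(1,2) show ?thesis
    unfolding mix_free_provable_def by (intro exI[of _ "Node r (A \<turnstile> B) [Q1, Q2]"]) simp
qed

lemmas mfp_refl = mfp_axiom[OF ax_id, simplified]
lemmas mfp_bot = mfp_axiom[OF ax_bot, simplified]
lemmas mfp_conj = mfp_step2[OF conj, simplified]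
lemmas mfp_diamond = mfp_step2[OF diamond, simplified]
lemmas mfp_triangle = mfp_step2[OF triangle, simplified]
lemmas mfp_star = mfp_step1[OF star, simplified]
lemmas mfp_plus_right = mfp_step1[OF plus_right, simplified]
lemmas mfp_plus_left = mfp_step1[OF plus_left, simplified]

lemma mfp_unit: "X \<^bold>\<and> \<^bold>\<top> \<tturnstile> D \<longleftrightarrow> X \<tturnstile> D"
  using mfp_step1[OF tau[of Hole X D]] mfp_step1[OF tau_inv[of Hole X D]]
  by (auto simp: one_hole_def)

lemma mfp_assoc: "(X \<^bold>\<and> Y) \<^bold>\<and> Z \<tturnstile> D \<longleftrightarrow> X \<^bold>\<and> (Y \<^bold>\<and> Z) \<tturnstile> D"
  using mfp_step1[OF beta_left[of Hole X Y Z D]] mfp_step1[OF beta_right[of Hole X Y Z D]]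
  by (auto simp: one_hole_def)

lemma mfp_exchange: "X \<^bold>\<and> Y \<tturnstile> D \<Longrightarrow> Y \<^bold>\<and> X \<tturnstile> D"
  using mfp_step1[OF gamma[of Hole X Y D]] by (simp add: one_hole_def)

lemma mfp_exchange_left: "(X \<^bold>\<and> Y) \<^bold>\<and> E \<tturnstile> D \<Longrightarrow> (Y \<^bold>\<and> X) \<^bold>\<and> E \<tturnstile> D"
  using mfp_step1[OF gamma[of "CtxtL Hole E" X Y D]] by (simp add: one_hole_def)

lemma mfp_contract: "X \<^bold>\<and> X \<tturnstile> D \<Longrightarrow> X \<tturnstile> D"
  using mfp_step1[OF omega[of Hole X D]] by (simp add: one_hole_def)

lemma mfp_contract_left: "(X \<^bold>\<and> X) \<^bold>\<and> E \<tturnstile> D \<Longrightarrow> X \<^bold>\<and> E \<tturnstile> D"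
  using mfp_step1[OF omega[of "CtxtL Hole E" X D]] by (simp add: one_hole_def)

text \<open>
  Weakening is not a rule, but \<open>\<top>\<close> can be added as a conjunct and then replaced by any
  formula.
\<close>

lemma mfp_weaken: "X \<tturnstile> D \<Longrightarrow> X \<^bold>\<and> Y \<tturnstile> D"
  using mfp_step1[OF theta[of "CtxtR X Hole" D Y]] by (simp add: one_hole_def mfp_unit)

lemma mfp_weaken_left:
  assumes "X \<^bold>\<and> E \<tturnstile> D"
  shows "(X \<^bold>\<and> Y) \<^bold>\<and> E \<tturnstile> D"
  using mfp_weaken[OF mfp_exchange[OF assms], of Y] mfp_assoc mfp_exchange by blast

section \<open>Antecedents that force a formula\<close>

text \<open>
  Conjunction and implication are read as usual on antecedents ordered by adding conjuncts. For
  disjunction and falsity the union and the empty set would be too small, since a left rule can use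
  \<open>A \<or> B\<close> or \<open>\<bottom>\<close> without deciding a disjunct; they are replaced by their closures,
  the intersections of all sets \<open>{X. X \<and> E \<tturnstile> D}\<close> that contain them.
\<close>

primrec val :: "'l form \<Rightarrow> 'l form set" where
  "val (Letter p) = {X. X \<tturnstile> Letter p}"
| "val \<^bold>\<top> = UNIV"
| "val \<^bold>\<bottom> = {X. \<forall>E D. X \<^bold>\<and> E \<tturnstile> D}"
| "val (A \<^bold>\<and> B) = val A \<inter> val B"
| "val (A \<^bold>\<or> B) = {X. \<forall>E D. (\<forall>Y \<in> val A \<union> val B. Y \<^bold>\<and> E \<tturnstile> D) \<longrightarrow> X \<^bold>\<and> E \<tturnstile> D}"
| "val (A \<^bold>\<rightarrow> B) = {X. \<forall>Y \<in> val A. X \<^bold>\<and> Y \<in> val B}"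

text \<open>
  The closure property passes through the connectives because the tests
  \<open>{X. X \<and> E \<tturnstile> D}\<close> are stable under moving a conjunct into \<open>E\<close>: a test on
  \<open>X \<and> Y\<close> is a test on \<open>X\<close> with the side formula \<open>Y \<and> E\<close>. A letter is
  handled by the trivial side formula \<open>\<top>\<close>.
\<close>

lemma val_closed:
  assumes "\<And>E D. (\<And>Y. Y \<in> val A \<Longrightarrow> Y \<^bold>\<and> E \<tturnstile> D) \<Longrightarrow> X \<^bold>\<and> E \<tturnstile> D"
  shows "X \<in> val A"
  using assms
proof (induction A arbitrary: X)
  case (Letter p)
  have "X \<^bold>\<and> \<^bold>\<top> \<tturnstile> Letter p"
    by (rule Letter) (simp add: mfp_unit)
  then show ?case by (simp add: mfp_unit)
next
  case Top
  then show ?case by simp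
next
  case Bot
  have "X \<^bold>\<and> E \<tturnstile> D" for E D
    by (rule Bot) simp
  then show ?case by (simp only: val.simps) blast
next
  case (And A B)
  have "X \<in> val A"
    by (rule And.IH(1)) (rule And.prems, simp)
  moreover have "X \<in> val B"
    by (rule And.IH(2)) (rule And.prems, simp)
  ultimately show ?case by simp
next
  case (Or A B)
  have "X \<^bold>\<and> E \<tturnstile> D" if "\<forall>Y \<in> val A \<union> val B. Y \<^bold>\<and> E \<tturnstile> D" for E D
    by (rule Or.prems) (use that in simp)
  then show ?case by simp
next
  case (Imp A B)
  have "X \<^bold>\<and> Y \<in> val B" if Y: "Y \<in> val A" for Y
  proof (rule Imp.IH(2))
    fix E D
    assume test: "\<And>Z. Z \<in> val B \<Longrightarrow> Z \<^bold>\<and> E \<tturnstile> D"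
    have "W \<^bold>\<and> (Y \<^bold>\<and> E) \<tturnstile> D" if "W \<in> val (A \<^bold>\<rightarrow> B)" for W
      using test[of "W \<^bold>\<and> Y"] that Y by (simp add: mfp_assoc)
    then have "X \<^bold>\<and> (Y \<^bold>\<and> E) \<tturnstile> D"
      by (rule Imp.prems)
    then show "(X \<^bold>\<and> Y) \<^bold>\<and> E \<tturnstile> D"
      by (simp add: mfp_assoc)
  qed
  then show ?case by simp
qed

lemma val_weaken: "X \<in> val A \<Longrightarrow> X \<^bold>\<and> Y \<in> val A"
  by (rule val_closed) (rule mfp_weaken_left)

lemma val_exchange: "X \<^bold>\<and> Y \<in> val A \<Longrightarrow> Y \<^bold>\<and> X \<in> val A"
  by (rule val_closed) (rule mfp_exchange_left)

lemma val_weaken': "X \<in> val A \<Longrightarrow> Y \<^bold>\<and> X \<in> val A"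
  by (rule val_exchange) (rule val_weaken)

lemma val_contract: "X \<^bold>\<and> X \<in> val A \<Longrightarrow> X \<in> val A"
  by (rule val_closed) (rule mfp_contract_left)

section \<open>Forcing and mix-free provability\<close>

text \<open>
  The two halves must be proved together because of implication. That \<open>A \<rightarrow> B\<close> forces
  itself needs the second half for \<open>A\<close>, which supplies the left premise of the rule for
  implication on the left, and the first half for \<open>B\<close>, which supplies the right one through
  closedness. That forcing \<open>A \<rightarrow> B\<close> gives a proof needs the halves the other way round:
  the antecedent \<open>A\<close>, which forces itself, is added, and the proof obtained for \<open>B\<close> is
  discharged.
\<close>

lemma val_adequate: "A \<in> val A \<and> (\<forall>X \<in> val A. X \<tturnstile> A)"
proof (induction A)
  case (Letter p)
  show ?case by (simp add: mfp_refl)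
next
  case Top
  have "X \<tturnstile> \<^bold>\<top>" for X :: "'a form"
    using mfp_step1[OF theta[of Hole "\<^bold>\<top>" X]] mfp_refl[of "\<^bold>\<top>"] by (simp add: one_hole_def)
  then show ?case by simp
next
  case Bot
  have "X \<tturnstile> \<^bold>\<bottom>" if "X \<in> val \<^bold>\<bottom>" for X :: "'a form"
    using that mfp_unit[of X] by simp
  moreover have "\<^bold>\<bottom> \<in> val (\<^bold>\<bottom> :: 'a form)"
    using mfp_weaken[OF mfp_bot] by auto
  ultimately show ?case by blast
next
  case (And A B)
  have "A \<^bold>\<and> B \<in> val (A \<^bold>\<and> B)"
    using And.IH val_weaken[of A A B] val_weaken'[of B B A] by simp
  moreover have "X \<tturnstile> A \<^bold>\<and> B" if "X \<in> val (A \<^bold>\<and> B)" for X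
    by (rule mfp_contract, rule mfp_conj) (use that And.IH in simp_all)
  ultimately show ?case by blast
next
  case (Or A B)
  have "A \<^bold>\<or> B \<in> val (A \<^bold>\<or> B)"
    using Or.IH by (auto intro: mfp_diamond)
  moreover have "X \<tturnstile> A \<^bold>\<or> B" if "X \<in> val (A \<^bold>\<or> B)" for X
  proof -
    have "\<forall>Y \<in> val A \<union> val B. Y \<^bold>\<and> \<^bold>\<top> \<tturnstile> A \<^bold>\<or> B"
      using Or.IH by (auto simp: mfp_unit intro: mfp_plus_right mfp_plus_left)
    then have "X \<^bold>\<and> \<^bold>\<top> \<tturnstile> A \<^bold>\<or> B"
      using that by simp
    then show ?thesis by (simp add: mfp_unit)
  qed
  ultimately show ?case by blast
next
  case (Imp A B)
  have "(A \<^bold>\<rightarrow> B) \<^bold>\<and> Y \<in> val B" if "Y \<in> val A" for Y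
  proof (rule val_exchange, rule val_closed)
    fix E D
    assume "\<And>Z. Z \<in> val B \<Longrightarrow> Z \<^bold>\<and> E \<tturnstile> D"
    then have "B \<^bold>\<and> E \<tturnstile> D" using Imp.IH(2) by blast
    moreover have "Y \<tturnstile> A" using that Imp.IH(1) by blast
    ultimately show "(Y \<^bold>\<and> (A \<^bold>\<rightarrow> B)) \<^bold>\<and> E \<tturnstile> D"
      using mfp_triangle by blast
  qed
  moreover have "X \<tturnstile> A \<^bold>\<rightarrow> B" if "X \<in> val (A \<^bold>\<rightarrow> B)" for X
  proof (rule mfp_star, rule mfp_exchange)
    show "X \<^bold>\<and> A \<tturnstile> B" using that Imp.IH by simp
  qed
  ultimately show ?case by simp
qed

section \<open>Soundness of the whole system and elimination of mix\<close>

lemma val_fill_mono: "val A \<subseteq> val B \<Longrightarrow> val (fill G A) \<subseteq> val (fill G B)"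
  by (induction G) auto

text \<open>
  A member \<open>X\<close> of \<open>val (A \<or> B)\<close> need not lie in \<open>val A\<close> or in \<open>val B\<close>,
  so elimination of the disjunction goes through a test for \<open>D\<close>. Every member \<open>Y\<close> of
  \<open>val A\<close> or \<open>val B\<close> passes it after \<open>X\<close> is added; moving \<open>X\<close> to the
  side formula gives a test that \<open>X\<close> itself passes, and the two copies of \<open>X\<close> are
  contracted.
\<close>

lemma val_diamond:
  assumes "val A \<inter> val C \<subseteq> val D" and "val B \<inter> val C \<subseteq> val D"
  shows "val (A \<^bold>\<or> B) \<inter> val C \<subseteq> val D"
proof
  fix X
  assume X: "X \<in> val (A \<^bold>\<or> B) \<inter> val C"
  show "X \<in> val D"
  proof (rule val_closed)
    fix E D'
    assume test: "\<And>Z. Z \<in> val D \<Longrightarrow> Z \<^bold>\<and> E \<tturnstile> D'"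
    have "Y \<^bold>\<and> (X \<^bold>\<and> E) \<tturnstile> D'" if "Y \<in> val A \<union> val B" for Y
    proof -
      have "Y \<^bold>\<and> X \<in> val A \<union> val B" using that val_weaken by auto
      moreover have "Y \<^bold>\<and> X \<in> val C" using X val_weaken' by auto
      ultimately have "Y \<^bold>\<and> X \<in> val D" using assms by blast
      then show ?thesis using test by (simp add: mfp_assoc[symmetric])
    qed
    then have "X \<^bold>\<and> (X \<^bold>\<and> E) \<tturnstile> D'" using X by simp
    then show "X \<^bold>\<and> E \<tturnstile> D'"
      by (rule mfp_contract_left[OF mfp_assoc[THEN iffD2]])
  qed
qed

fun valid :: "'l sequent \<Rightarrow> bool" where
  "valid (A \<turnstile> B) \<longleftrightarrow> val A \<subseteq> val B"

text \<open>
  On values, conjunction is intersection and \<open>\<top>\<close> is neutral, so each structural rule other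
  than mix replaces the formula in the hole by one with a smaller or equal value. Mix needs no
  separate idea: its first premise is such an inclusion.
\<close>

lemma inference_valid:
  assumes "inference r ps s" and "\<forall>p \<in> set ps. valid p"
  shows "valid s"
proof -
  have replace: "valid (fill F A \<turnstile> C)"
    if "valid (fill F B \<turnstile> C)" and "val A \<subseteq> val B" for F and B C A :: "'a form"
    using that val_fill_mono[of A B F] by auto
  show ?thesis
    using assms
  proof cases
    case (ax_bot A)
    have "X \<in> val A" if "X \<in> val \<^bold>\<bottom>" for X
      by (rule val_closed) (use that in simp)
    then show ?thesis using ax_bot by auto
  next
    case (beta_left F A B C D)
    then show ?thesis using assms(2) replace[of F "A \<^bold>\<and> (B \<^bold>\<and> C)" D "(A \<^bold>\<and> B) \<^bold>\<and> C"] by auto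
  next
    case (beta_right F A B C D)
    then show ?thesis using assms(2) replace[of F "(A \<^bold>\<and> B) \<^bold>\<and> C" D "A \<^bold>\<and> (B \<^bold>\<and> C)"] by auto
  next
    case (gamma F A B C)
    then show ?thesis using assms(2) replace[of F "A \<^bold>\<and> B" C "B \<^bold>\<and> A"] by auto
  next
    case (omega F A B)
    then show ?thesis using assms(2) replace[of F "A \<^bold>\<and> A" B A] by auto
  next
    case (theta F B A)
    then show ?thesis using assms(2) replace[of F "\<^bold>\<top>" B A] by auto
  next
    case (tau F A B)
    then show ?thesis using assms(2) replace[of F A B "A \<^bold>\<and> \<^bold>\<top>"] by auto
  next
    case (tau_inv F A B)
    then show ?thesis using assms(2) replace[of F "A \<^bold>\<and> \<^bold>\<top>" B A] by auto
  next
    case (mix A B G C)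
    then show ?thesis using assms(2) replace[of G B C A] by auto
  next
    case (diamond A C D B)
    then show ?thesis using assms(2) val_diamond[of A C D B] by simp
  next
    case (star A B C)
    have "X \<^bold>\<and> Y \<in> val C" if "X \<in> val B" "Y \<in> val A" for X Y
      using star assms(2) that val_weaken val_weaken' by fastforce
    then show ?thesis using star by auto
  next
    case (triangle A B C D E)
    have "X \<in> val E" if X: "X \<in> val A" "X \<in> val (B \<^bold>\<rightarrow> C)" "X \<in> val D" for X
    proof -
      have "X \<in> val B" using triangle assms(2) X(1) by auto
      then have "X \<in> val C" using X(2) by (auto intro: val_contract)
      then show ?thesis using triangle assms(2) X(3) by auto
    qed
    then show ?thesis using triangle by auto
  qed auto
qed

lemma val_sound: "is_proof P \<Longrightarrow> valid (root P)"
proof (induction P)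
  case (Node r s ts)
  then show ?case using inference_valid[of r "map root ts" s] by auto
qed

theorem theorem4p3:
  fixes A B :: "'l::countable form" and P :: "'l tree"
  assumes "is_proof P" and "root P = (A \<turnstile> B)"
  shows "\<exists>Q. is_proof Q \<and> root Q = (A \<turnstile> B) \<and> mix_free Q"
proof -
  have "val A \<subseteq> val B"
    using val_sound[OF assms(1)] assms(2) by simp
  then have "A \<tturnstile> B"
    using val_adequate by blast
  then show ?thesis
    unfolding mix_free_provable_def .
qed

end
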